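(* Let $p\in(1,\infty]$ (resp. $p=1$) with conjugate exponent $q$, let $x:[0,\infty)\to\mathbb{R}$ be continuous, and let $\Pi=(\pi_n)_n$ be a fixed sequence of partitions of $[0,\infty)$ such that $O_t(x,\pi_n)\to0$ for all $t\in[0,\infty)$. If $x\in\mathcal{L}_p^\Pi$, $g_n,g\in W^{1,q}$, $g_n(x_0)\to g(x_0)$ and $g_n'\to g'$ in the weak (resp. weak$^*$) topology of $L^q$, then $$\int_0^t g_n(x_s)\,dx_s\to\int_0^t g(x_s)\,dx_s\quad\text{for all }t\in[0,\infty),$$ and the convergence is uniform on compacts if moreover $|g_n'|\to|g'|$ weakly (resp. weakly$^*$) in $L^q$.
   Context: A partition of $[0,\infty)$ is a sequence $\pi=(t_k)_{k\in\mathbb{N}}$ in $[0,\infty]$ with $t_0=0$, $t_k<t_{k+1}$ whenever $t_{k+1}<\infty$, and $\lim_k t_k=\infty$; set $x_\infty:=0$. $O_t(x,\pi):=\max\{|x(b)-x(a)|:a,b\in[t_k,t_{k+1})\cap[0,t]\text{ for some }k\}$ (understood as a supremum). For $a,b\in\mathbb{R}$ let $[\![a,b)\!)$ denote $[a,b)$ if $a\le b$ and $[b,a)$ if $a>b$. The discrete local time of $x$ along $\pi$ is $$L^{\pi}_t(u):=2\sum_{t_j\in\pi}\mathbf{1}_{[\![x_{t_j\wedge t},\,x_{t_{j+1}\wedge t})\!)}(u)\,|x_{t_{j+1}\wedge t}-u|.$$ $\mathcal{L}_p^\Pi$ is the set of continuous $x$ with $O_t(x,\pi_n)\to0$ for all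 $t$ such that, for all $t\in[0,\infty)$, $(L^{\pi_n}_t)_n$ converges weakly in $L^p(\mathbb{R},du)$ (weakly$^*$ if $p=\infty$) to some $L_t\in L^p$, and $t\mapsto L_t\in L^p$ is continuous for the weak (resp. weak$^*$ if $p=\infty$) topology. $W^{1,q}$ is the set of (locally) absolutely continuous functions on $\mathbb{R}$ whose a.e. derivative is in $L^q(\mathbb{R})$. For $x\in\mathcal{L}_p^\Pi$ and $g\in W^{1,q}$, $\int_0^tg(x_s)\,dx_s:=\lim_n\sum_{t_j\in\pi_n}g(x_{t_j})(x_{t_{j+1}\wedge t}-x_{t_j\wedge t})$, a limit which exists for every $t$. *)

theory Defs
  imports "HOL-Analysis.Analysis"
begin

text \<open>Elements of \<open>L\<^sup>p(\<real>, du)\<close> are represented by Lebesgue measurable functions, not by classes modulo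
  null sets. The topology below does not separate functions that agree almost everywhere.\<close>

definition Lp :: "ennreal \<Rightarrow> (real \<Rightarrow> real) set" where
  "Lp p = {f \<in> borel_measurable lebesgue.
     if p = \<infinity> then \<exists>C. AE u in lebesgue. \<bar>f u\<bar> \<le> C
     else integrable lebesgue (\<lambda>u. \<bar>f u\<bar> powr enn2real p)}"

text \<open>Only meant for \<open>1 \<le> p < \<infinity>\<close>.\<close>

definition Lp_norm :: "ennreal \<Rightarrow> (real \<Rightarrow> real) \<Rightarrow> real" where
  "Lp_norm p f = (LINT u|lebesgue. \<bar>f u\<bar> powr enn2real p) powr (1 / enn2real p)"

definition Lp_dual :: "ennreal \<Rightarrow> ((real \<Rightarrow> real) \<Rightarrow> real) set" where
  "Lp_dual p = {\<Phi>.
     (\<forall>f\<in>Lp p. \<forall>h\<in>Lp p. \<Phi> (\<lambda>u. f u + h u) = \<Phi> f + \<Phi> h) \<and>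
     (\<forall>c. \<forall>f\<in>Lp p. \<Phi> (\<lambda>u. c * f u) = c * \<Phi> f) \<and>
     (\<exists>C. \<forall>f\<in>Lp p. \<bar>\<Phi> f\<bar> \<le> C * Lp_norm p f)}"

text \<open>The weak topology of \<open>L\<^sup>p\<close> if \<open>p < \<infinity>\<close>, and the weak* topology of
  \<open>L\<^sup>\<infinity>\<close> as the dual of \<open>L\<^sup>1\<close> if \<open>p = \<infinity>\<close>: the initial topology for
  the functionals in \<open>Lp_weak_functionals p\<close>.\<close>

definition Lp_weak_functionals :: "ennreal \<Rightarrow> ((real \<Rightarrow> real) \<Rightarrow> real) set" where
  "Lp_weak_functionals p =
     (if p = \<infinity> then {\<lambda>f. LINT u|lebesgue. f u * h u | h. h \<in> Lp 1} else Lp_dual p)"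

definition Lp_weak :: "ennreal \<Rightarrow> (real \<Rightarrow> real) topology" where
  "Lp_weak p = topology_generated_by
     {{f \<in> Lp p. \<Phi> f \<in> U} | \<Phi> U. \<Phi> \<in> Lp_weak_functionals p \<and> open U}"

definition absolutely_continuous_on_set :: "real set \<Rightarrow> (real \<Rightarrow> real) \<Rightarrow> bool" where
  "absolutely_continuous_on_set S f \<longleftrightarrow>
     (\<forall>\<epsilon>>0. \<exists>\<delta>>0. \<forall>D T. D division_of T \<longrightarrow> T \<subseteq> S \<longrightarrow> (\<Sum>I\<in>D. Sup I - Inf I) < \<delta> \<longrightarrow>
        (\<Sum>I\<in>D. \<bar>f (Sup I) - f (Inf I)\<bar>) < \<epsilon>)"

text \<open>The almost everywhere differentiability in the next definition follows from absolute
  continuity (Lebesgue). It is listed since \<open>deriv g\<close> is an arbitrary value at points where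
  \<open>g\<close> is not differentiable.\<close>

definition W1 :: "ennreal \<Rightarrow> (real \<Rightarrow> real) set" where
  "W1 q = {g. (\<forall>a b. absolutely_continuous_on_set {a..b} g) \<and>
              (AE u in lebesgue. g differentiable (at u)) \<and> deriv g \<in> Lp q}"

definition time_partition :: "(nat \<Rightarrow> ennreal) \<Rightarrow> bool" where
  "time_partition \<pi> \<longleftrightarrow>
     \<pi> 0 = 0 \<and> (\<forall>k. \<pi> (Suc k) < \<infinity> \<longrightarrow> \<pi> k < \<pi> (Suc k)) \<and> \<pi> \<longlonglongrightarrow> \<infinity>"

text \<open>Paths on \<open>[0,\<infinity>)\<close> are functions on the reals of which only the values at nonnegative times
  are used; they are evaluated at times in \<open>[0,\<infinity>]\<close> with the convention \<open>x\<^sub>\<infinity> = 0\<close>.\<close>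

definition path_at :: "(real \<Rightarrow> real) \<Rightarrow> ennreal \<Rightarrow> real" where
  "path_at x s = (if s = \<infinity> then 0 else x (enn2real s))"

definition osc :: "(real \<Rightarrow> real) \<Rightarrow> (nat \<Rightarrow> ennreal) \<Rightarrow> real \<Rightarrow> real" where
  "osc x \<pi> t = Sup {\<bar>x b - x a\<bar> | a b k.
     a \<in> {0..t} \<and> b \<in> {0..t} \<and>
     ennreal a \<in> {\<pi> k..<\<pi> (Suc k)} \<and> ennreal b \<in> {\<pi> k..<\<pi> (Suc k)}}"

definition oriented_Ico :: "real \<Rightarrow> real \<Rightarrow> real set" where
  "oriented_Ico a b = (if a \<le> b then {a..<b} else {b..<a})"

text \<open>The series in the next definition and in \<open>riemann_sum\<close> have finitely many nonzero terms,
  since all terms with \<open>\<pi> j \<ge> t\<close> vanish.\<close>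

definition disc_local_time ::
    "(real \<Rightarrow> real) \<Rightarrow> (nat \<Rightarrow> ennreal) \<Rightarrow> real \<Rightarrow> real \<Rightarrow> real" where
  "disc_local_time x \<pi> t u =
     2 * (\<Sum>j. indicator (oriented_Ico (path_at x (min (\<pi> j) (ennreal t)))
                                      (path_at x (min (\<pi> (Suc j)) (ennreal t)))) u
              * \<bar>path_at x (min (\<pi> (Suc j)) (ennreal t)) - u\<bar>)"

definition local_time_paths ::
    "ennreal \<Rightarrow> (nat \<Rightarrow> nat \<Rightarrow> ennreal) \<Rightarrow> (real \<Rightarrow> real) set" where
  "local_time_paths p \<pi>s = {x.
     continuous_on {0..} x \<and>
     (\<forall>t\<ge>0. (\<lambda>n. osc x (\<pi>s n) t) \<longlonglongrightarrow> 0) \<and>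
     (\<exists>L. (\<forall>t\<ge>0. limitin (Lp_weak p) (\<lambda>n. disc_local_time x (\<pi>s n) t) (L t) sequentially) \<and>
          continuous_map (top_of_set {0..}) (Lp_weak p) L)}"

definition riemann_sum ::
    "(real \<Rightarrow> real) \<Rightarrow> (real \<Rightarrow> real) \<Rightarrow> (nat \<Rightarrow> ennreal) \<Rightarrow> real \<Rightarrow> real" where
  "riemann_sum g x \<pi> t =
     (\<Sum>j. g (path_at x (\<pi> j)) *
          (path_at x (min (\<pi> (Suc j)) (ennreal t)) - path_at x (min (\<pi> j) (ennreal t))))"

text \<open>The integral \<open>\<integral>\<^sub>0\<^sup>t g(x\<^sub>s) dx\<^sub>s\<close> along \<open>\<pi>s\<close>. The limit exists for
  \<open>x \<in> local_time_paths p \<pi>s\<close>, \<open>g \<in> W1 q\<close> and \<open>1/p + 1/q = 1\<close>.\<close>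

definition pathwise_integral ::
    "(real \<Rightarrow> real) \<Rightarrow> (real \<Rightarrow> real) \<Rightarrow> (nat \<Rightarrow> nat \<Rightarrow> ennreal) \<Rightarrow> real \<Rightarrow> real" where
  "pathwise_integral g x \<pi>s t = lim (\<lambda>n. riemann_sum g x (\<pi>s n) t)"

end

theory Submission
  imports Defs
begin

text \<open>
  Everything rests on the kernel \<open>K a b u = 1\<^bsub>[[a,b))\<^esub>(u) \<bar>b - u\<bar>\<close>, called \<open>local_time_kernel\<close> below. It is
  the kernel of the first order Taylor remainder: if \<open>g\<close> is absolutely continuous and \<open>G' = g\<close>, then
  \<open>G b - G a - g a (b - a) = \<integral> K a b u g' u du\<close>. Since \<open>L\<^sup>\<pi>\<^sub>t\<close> is twice the sum of the kernels
  along \<open>\<pi>\<close>, adding up these remainders gives a discrete Tanaka formula (\<open>discrete_Tanaka_formula\<close>)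

  \<open>\<Sum> g (x t\<^sub>j) \<Delta>x\<^sub>j = g (x 0) (x t - x 0) + \<integral> K (x 0) (x t) u g' u du - (1/2) \<integral> L\<^sup>\<pi>\<^sub>t u g' u du\<close>,

  in which the sum of the first two terms on the right is \<open>G (x t) - G (x 0)\<close>. Along the given sequence of
  partitions, weak convergence of the discrete local times replaces \<open>L\<^sup>\<pi>\<^sub>t\<close> by \<open>L\<^sub>t\<close>, so the pathwise
  integral equals \<open>A g (x t) - (1/2) B g' t\<close> with \<open>A g y = g (x 0) (y - x 0) + \<integral> K (x 0) y u g' u du\<close>
  and \<open>B h t = \<integral> L\<^sub>t u h u du\<close> (\<open>pathwise_integral_eq\<close>). As \<open>K (x 0) y\<close> and \<open>L\<^sub>t\<close> lie in
  \<open>L\<^sup>p\<close>, they may be tested against the weakly convergent sequence \<open>g\<^sub>n'\<close>. This is the pointwise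
  convergence.

  For uniform convergence, pointwise convergence has to be combined with control of the increments.
  When the time increases from \<open>s\<close> to \<open>t\<close>, the discrete local time decreases by at most twice the
  oscillation of the path along the partition, since only the summand of the interval containing \<open>s\<close> can decrease
  (\<open>disc_local_time_almost_mono\<close>). In the limit, \<open>L\<^sub>t\<close> increases with \<open>t\<close> up to null sets, and
  \<open>\<bar>B h t - B h s\<bar> \<le> B \<bar>h\<bar> t - B \<bar>h\<bar> s\<close> (\<open>local_time_integral_increment\<close>).
  If also \<open>\<bar>g\<^sub>n'\<bar>\<close> converges weakly to \<open>\<bar>g'\<bar>\<close>, the monotone functions \<open>B \<bar>g\<^sub>n'\<bar>\<close> converge pointwise to the
  continuous function \<open>B \<bar>g'\<bar>\<close>, which by the argument of Polya and Dini makes the convergence of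
  \<open>B g\<^sub>n'\<close> uniform (\<open>uniform_limit_of_dominated_increments\<close>). The same lemma applies to the
  functions \<open>A g\<^sub>n\<close> on a compact interval: there they are Lipschitz with constants
  \<open>\<bar>g\<^sub>n (x 0)\<bar> + \<integral> \<bar>g\<^sub>n'\<bar>\<close>, the integral being over the interval, and these constants converge.
\<close>

section \<open>The fundamental theorem of calculus for absolutely continuous functions\<close>

text \<open>The form in which absolute continuity enters the gauge integral. The only difference to the
  definition is that one interval may occur in a tagged division with several tags; it is then
  degenerate and contributes nothing.\<close>

lemma absolutely_continuous_small_variation:
  fixes g :: "real \<Rightarrow> real"
  assumes ac: "absolutely_continuous_on_set {a..b} g" and "\<epsilon> > 0"
  obtains \<delta> where "\<delta> > 0"
    "\<And>p. p tagged_partial_division_of {a..b} \<Longrightarrow> (\<Sum>(x, K)\<in>p. measure lborel K) < \<delta> \<Longrightarrow>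
          (\<Sum>(x, K)\<in>p. \<bar>g (Sup K) - g (Inf K)\<bar>) < \<epsilon>"
proof -
  obtain \<delta> where \<delta>: "\<delta> > 0"
    "\<And>D T. D division_of T \<Longrightarrow> T \<subseteq> {a..b} \<Longrightarrow> (\<Sum>I\<in>D. Sup I - Inf I) < \<delta> \<Longrightarrow>
        (\<Sum>I\<in>D. \<bar>g (Sup I) - g (Inf I)\<bar>) < \<epsilon>"
    using ac \<open>\<epsilon> > 0\<close> unfolding absolutely_continuous_on_set_def by meson
  show ?thesis
  proof (rule that[OF \<delta>(1)])
    fix p assume p: "p tagged_partial_division_of {a..b}" "(\<Sum>(x, K)\<in>p. measure lborel K) < \<delta>"
    have pU: "p tagged_division_of \<Union>(snd ` p)"
      using p(1) by (rule tagged_partial_division_of_Union_self)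
    have div: "snd ` p division_of \<Union>(snd ` p)"
      using pU by (rule division_of_tagged_division)
    have sub: "\<Union>(snd ` p) \<subseteq> {a..b}"
      using p(1) by (force dest: tagged_partial_division_ofD(3))
    have Ik: "\<exists>u v. u \<le> v \<and> I = {u..v}" if "I \<in> snd ` p" for I
      using division_ofD(3,4)[OF div that] by fastforce
    have eq: "(\<Sum>(x, K)\<in>p. d K) = sum d (snd ` p)"
      if "\<And>u. d {u} = 0" for d :: "real set \<Rightarrow> real"
    proof -
      have "(\<Sum>(x, K)\<in>p. d K) = (\<Sum>(x, K)\<in>p. if K = {} then 0 else d K)"
        by (rule sum.cong) (use Ik in force)+
      also have "\<dots> = (\<Sum>K\<in>snd ` p. if K = {} then 0 else d K)"
      proof (rule sum.over_tagged_division_lemma[OF pU])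
        fix u v :: real assume "box u v = {}"
        then show "(if cbox u v = {} then 0 else d (cbox u v)) = 0"
          using that[of u] by (cases "u = v") auto
      qed
      also have "\<dots> = sum d (snd ` p)"
        by (rule sum.cong) (use Ik in fastforce)+
      finally show ?thesis .
    qed
    have "(\<Sum>I\<in>snd ` p. Sup I - Inf I) = (\<Sum>I\<in>snd ` p. measure lborel I)"
      by (rule sum.cong) (use Ik in fastforce)+
    also have "\<dots> = (\<Sum>(x, K)\<in>p. measure lborel K)"
      by (rule eq[symmetric]) auto
    finally have "(\<Sum>I\<in>snd ` p. Sup I - Inf I) < \<delta>" using p(2) by simp
    from \<delta>(2)[OF div sub this]
    show "(\<Sum>(x, K)\<in>p. \<bar>g (Sup K) - g (Inf K)\<bar>) < \<epsilon>"
      by (subst eq) auto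
  qed
qed

text \<open>A gauge is chosen so that two kinds of intervals of a fine division are controlled. If the tag is
  a point of differentiability, the interval is so short that the increment of \<open>g\<close> agrees with \<open>h\<close>
  times its length up to a small multiple of the length (straddle lemma). If the tag lies in the null set
  \<open>N\<close>, the interval is inside an open set of small measure that contains \<open>N\<close>, and absolute
  continuity bounds the total variation over all these intervals.\<close>

lemma fundamental_theorem_of_calculus_absolutely_continuous:
  fixes g :: "real \<Rightarrow> real"
  assumes "a \<le> b" and ac: "absolutely_continuous_on_set {a..b} g"
    and neg: "negligible N"
    and der: "\<And>u. u \<in> {a..b} - N \<Longrightarrow> (g has_real_derivative h u) (at u)"
  shows "(h has_integral (g b - g a)) {a..b}"
proof -
  \<comment> \<open>A function may be changed on a null set, and this choice lets the tags in \<open>N\<close> drop out of the Riemann sums.\<close>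
  define h0 where "h0 u = (if u \<in> N then 0 else h u)" for u
  have "(h0 has_integral (g b - g a)) {a..b}"
    unfolding has_integral_real
  proof (intro allI impI)
    fix \<epsilon> :: real assume "\<epsilon> > 0"
    define e where "e = \<epsilon> / (2 * (b - a + 1))"
    have "e > 0" using \<open>\<epsilon> > 0\<close> \<open>a \<le> b\<close> by (simp add: e_def)
    have "e * (b - a) < \<epsilon> / 2"
      using \<open>\<epsilon> > 0\<close> \<open>a \<le> b\<close> by (simp add: e_def field_simps)
    have "\<exists>d>0. \<forall>y. \<bar>y - u\<bar> < d \<longrightarrow> \<bar>g y - g u - h u * (y - u)\<bar> \<le> e * \<bar>y - u\<bar>"
      if "u \<in> {a..b} - N" for u
      using der[OF that] \<open>e > 0\<close>
      unfolding has_field_derivative_def has_derivative_within_alt by auto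
    then obtain d where d: "\<And>u. u \<in> {a..b} - N \<Longrightarrow> d u > 0"
      "\<And>u y. u \<in> {a..b} - N \<Longrightarrow> \<bar>y - u\<bar> < d u \<Longrightarrow> \<bar>g y - g u - h u * (y - u)\<bar> \<le> e * \<bar>y - u\<bar>"
      by metis
    obtain \<delta> where \<delta>: "\<delta> > 0"
      "\<And>p. p tagged_partial_division_of {a..b} \<Longrightarrow> (\<Sum>(x, K)\<in>p. measure lborel K) < \<delta> \<Longrightarrow>
          (\<Sum>(x, K)\<in>p. \<bar>g (Sup K) - g (Inf K)\<bar>) < \<epsilon> / 2"
      using absolutely_continuous_small_variation[OF ac half_gt_zero[OF \<open>\<epsilon> > 0\<close>]] by blast
    have Nleb: "N \<in> sets lebesgue" "N \<in> null_sets lebesgue"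
      using neg by (simp_all add: negligible_imp_sets negligible_iff_null_sets)
    obtain U where U: "open U" "N \<subseteq> U" "U - N \<in> lmeasurable" "emeasure lebesgue (U - N) < ennreal \<delta>"
      using sets_lebesgue_outer_open[OF Nleb(1) \<delta>(1)] by metis
    have Um: "U \<in> lmeasurable"
      using fmeasurable.Un[OF U(3) negligible_imp_measurable[OF neg]] U(2) by (simp add: Un_absorb2)
    have "measure lebesgue U < \<delta>"
    proof -
      have "emeasure lebesgue (U - N) = emeasure lebesgue U"
        using Nleb(2) Um by (intro emeasure_Diff_null_set) auto
      with U(4) have "emeasure lebesgue U < ennreal \<delta>" by simp
      then show ?thesis using \<delta>(1) Um
        by (simp add: emeasure_eq_measure2 ennreal_less_iff)
    qed
    define \<gamma> where "\<gamma> u = (if u \<in> N then U else if u \<in> {a..b} then ball u (d u) else ball u 1)" for u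
    have "gauge \<gamma>"
      unfolding gauge_def \<gamma>_def using U d(1) by auto
    moreover have "norm ((\<Sum>(x, K)\<in>\<D>. measure lborel K *\<^sub>R h0 x) - (g b - g a)) < \<epsilon>"
      if tag: "\<D> tagged_division_of {a..b}" and fine: "\<gamma> fine \<D>" for \<D>
    proof -
      define P where "P = {z \<in> \<D>. fst z \<in> N}"
      have fin: "finite \<D>" using tag by blast
      have P: "P \<subseteq> \<D>" "finite P" using fin by (auto simp: P_def)
      have Ptag: "P tagged_partial_division_of {a..b}"
        using tag P(1) by (meson tagged_division_of_def tagged_partial_division_subset)
      have PU: "P tagged_division_of \<Union>(snd ` P)"
        using Ptag by (rule tagged_partial_division_of_Union_self)
      \<comment> \<open>The intervals with tags in \<open>N\<close> do not overlap and lie in \<open>U\<close>, so their total length is small.\<close>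
      have "(\<Sum>(x, K)\<in>P. measure lborel K) = sum (measure lborel) (snd ` P)"
        by (rule sum.over_tagged_division_lemma[OF PU]) (simp add: content_eq_0_interior)
      also have "\<dots> = sum (measure lebesgue) (snd ` P)"
        by (rule sum.cong) (use division_ofD(4)[OF division_of_tagged_division[OF PU]] in force)+
      also have "\<dots> = measure lebesgue (\<Union>(snd ` P))"
        using content_division[OF division_of_tagged_division[OF PU]] by simp
      also have "\<dots> \<le> measure lebesgue U"
      proof (rule measure_mono_fmeasurable)
        show "\<Union>(snd ` P) \<subseteq> U"
          using fine unfolding fine_def P_def \<gamma>_def by force
        show "\<Union>(snd ` P) \<in> sets lebesgue"
          using division_of_tagged_division[OF PU] by (metis lmeasurable_division fmeasurableD)
      qed (rule Um)
      finally have "(\<Sum>(x, K)\<in>P. measure lborel K) < \<delta>" using \<open>measure lebesgue U < \<delta>\<close> by simp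
      from \<delta>(2)[OF Ptag this]
      have small: "(\<Sum>(x, K)\<in>P. \<bar>g (Sup K) - g (Inf K)\<bar>) < \<epsilon> / 2" .
      have K: "\<exists>u v. u \<le> v \<and> K = {u..v} \<and> x \<in> {u..v} \<and> {u..v} \<subseteq> {a..b} \<and> {u..v} \<subseteq> \<gamma> x"
        if xK: "(x, K) \<in> \<D>" for x K
      proof -
        obtain u v where "K = cbox u v" using tagged_division_ofD(4)[OF tag xK] by blast
        moreover have "x \<in> K" "K \<subseteq> {a..b}" using tagged_division_ofD(2,3)[OF tag xK] .
        moreover have "K \<subseteq> \<gamma> x" using fine xK by (auto simp: fine_def)
        ultimately show ?thesis by auto
      qed
      have len: "(\<Sum>(x, K)\<in>\<D>. Sup K - Inf K) = b - a"
        using additive_tagged_division_1[OF \<open>a \<le> b\<close> tag, of "\<lambda>x. x"] by simp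
      have "(\<Sum>(x, K)\<in>\<D>. measure lborel K *\<^sub>R h0 x) - (g b - g a)
          = (\<Sum>z\<in>\<D>. case z of (x, K) \<Rightarrow> measure lborel K *\<^sub>R h0 x - (g (Sup K) - g (Inf K)))"
        using additive_tagged_division_1[OF \<open>a \<le> b\<close> tag, of g]
        by (simp add: split_def sum_subtractf)
      also have "norm \<dots> \<le> (\<Sum>z\<in>\<D>. case z of (x, K) \<Rightarrow>
          e * (Sup K - Inf K) + (if x \<in> N then \<bar>g (Sup K) - g (Inf K)\<bar> else 0))"
      proof (rule sum_norm_le, safe)
        fix x K assume xK: "(x, K) \<in> \<D>"
        from K[OF this] obtain u v where uv: "u \<le> v" "K = {u..v}" "x \<in> {u..v}" "{u..v} \<subseteq> {a..b}" "{u..v} \<subseteq> \<gamma> x"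
          by blast
        show "norm (measure lborel K *\<^sub>R h0 x - (g (Sup K) - g (Inf K)))
           \<le> e * (Sup K - Inf K) + (if x \<in> N then \<bar>g (Sup K) - g (Inf K)\<bar> else 0)"
        proof (cases "x \<in> N")
          case True
          moreover have "0 \<le> e * (v - u)" using uv(1) \<open>e > 0\<close> by simp
          ultimately show ?thesis using uv by (simp add: h0_def)
        next
          case False
          then have x: "x \<in> {a..b} - N" using uv by auto
          then have "\<gamma> x = ball x (d x)" by (auto simp: \<gamma>_def)
          moreover have "u \<in> {u..v}" "v \<in> {u..v}" using uv by auto
          ultimately have "\<bar>u - x\<bar> < d x" "\<bar>v - x\<bar> < d x"
            using uv(5) by (auto simp: dist_real_def subset_iff abs_minus_commute)
          note * = d(2)[OF x this(1)] d(2)[OF x this(2)]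
          have "\<bar>(v - u) * h x - (g v - g u)\<bar>
              = \<bar>(g u - g x - h x * (u - x)) - (g v - g x - h x * (v - x))\<bar>"
            by (simp add: algebra_simps)
          also have "\<dots> \<le> e * \<bar>u - x\<bar> + e * \<bar>v - x\<bar>"
            using * by linarith
          also have "\<dots> = e * (v - u)" using uv(3) by (simp add: algebra_simps)
          finally show ?thesis using uv False by (simp add: h0_def)
        qed
      qed
      also have "\<dots> = e * (b - a) + (\<Sum>(x, K)\<in>P. \<bar>g (Sup K) - g (Inf K)\<bar>)"
        unfolding len[symmetric] P_def
        by (simp add: sum.distrib split_def sum_distrib_left sum.inter_filter[OF fin])
      also have "\<dots> < \<epsilon>" using small \<open>e * (b - a) < \<epsilon> / 2\<close> by simp
      finally show ?thesis .
    qed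
    ultimately show "\<exists>\<gamma>. gauge \<gamma> \<and> (\<forall>\<D>. \<D> tagged_division_of {a..b} \<and> \<gamma> fine \<D> \<longrightarrow>
        norm ((\<Sum>(x, K)\<in>\<D>. measure lborel K *\<^sub>R h0 x) - (g b - g a)) < \<epsilon>)"
      by (intro exI[of _ \<gamma>] conjI allI impI) auto
  qed
  then show ?thesis
    using has_integral_spike[OF neg, of "{a..b}" h h0] by (simp add: h0_def)
qed

section \<open>Duality of Lebesgue spaces\<close>

lemma Lp_top: "f \<in> Lp top \<longleftrightarrow> f \<in> borel_measurable lebesgue \<and> (\<exists>C. AE u in lebesgue. \<bar>f u\<bar> \<le> C)"
  by (simp add: Lp_def)

lemma Lp_1: "f \<in> Lp 1 \<longleftrightarrow> integrable lebesgue f"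
proof -
  have "integrable lebesgue f \<Longrightarrow> f \<in> borel_measurable lebesgue" by simp
  then show ?thesis
    by (auto simp: Lp_def integrable_abs_iff)
qed

lemma Lp_measurable: "f \<in> Lp p \<Longrightarrow> f \<in> borel_measurable lebesgue"
  by (simp add: Lp_def)

lemma Lp_abs: "f \<in> Lp p \<Longrightarrow> (\<lambda>u. \<bar>f u\<bar>) \<in> Lp p"
  by (auto simp: Lp_def)

text \<open>All kernels below are of this type, so that they can be tested against weakly convergent sequences and
  multiplied with elements of any Lebesgue space.\<close>

lemma bounded_support_Lp:
  assumes [measurable]: "f \<in> borel_measurable lebesgue"
    and bound: "\<And>u. \<bar>f u\<bar> \<le> C" and supp: "\<And>u. u \<notin> {-M..M} \<Longrightarrow> f u = 0"
  shows "f \<in> Lp p"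
proof (cases "p = \<infinity>")
  case True
  then show ?thesis using bound by (auto simp: Lp_top)
next
  case False
  have "integrable lebesgue (\<lambda>u. \<bar>f u\<bar> powr enn2real p)"
  proof (rule Bochner_Integration.integrable_bound)
    show "integrable lebesgue (\<lambda>u. C powr enn2real p * indicator {-M..M} u)"
      by (intro integrable_mult_right) (simp add: integrable_indicator_iff emeasure_lborel_Icc_eq)
    show "AE u in lebesgue. norm (\<bar>f u\<bar> powr enn2real p) \<le> norm (C powr enn2real p * indicator {-M..M} u)"
      using bound supp by (auto intro!: powr_mono2 split: split_indicator)
  qed measurable
  then show ?thesis using False by (simp add: Lp_def)
qed

lemma integrable_mult_AE_bounded:
  fixes f h :: "real \<Rightarrow> real"
  assumes f: "integrable lebesgue f" and [measurable]: "h \<in> borel_measurable lebesgue"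
    and bd: "AE u in lebesgue. \<bar>h u\<bar> \<le> C"
  shows "integrable lebesgue (\<lambda>u. f u * h u)" "\<bar>LINT u|lebesgue. f u * h u\<bar> \<le> \<bar>C\<bar> * (LINT u|lebesgue. \<bar>f u\<bar>)"
proof -
  have [measurable]: "f \<in> borel_measurable lebesgue" using f by simp
  have g: "integrable lebesgue (\<lambda>u. \<bar>C\<bar> * \<bar>f u\<bar>)" using f by simp
  have le: "AE u in lebesgue. \<bar>f u * h u\<bar> \<le> \<bar>C\<bar> * \<bar>f u\<bar>"
    using bd by eventually_elim (subst abs_mult, subst mult.commute, intro mult_right_mono, auto)
  show i: "integrable lebesgue (\<lambda>u. f u * h u)"
    by (rule Bochner_Integration.integrable_bound[OF g]) (use le in auto)
  have "\<bar>LINT u|lebesgue. f u * h u\<bar> \<le> (LINT u|lebesgue. \<bar>f u * h u\<bar>)"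
    by (rule integral_abs_bound)
  also have "\<dots> \<le> (LINT u|lebesgue. \<bar>C\<bar> * \<bar>f u\<bar>)"
    using i g le by (intro integral_mono_AE) auto
  finally show "\<bar>LINT u|lebesgue. f u * h u\<bar> \<le> \<bar>C\<bar> * (LINT u|lebesgue. \<bar>f u\<bar>)" by simp
qed

lemma Hoelder_inequality:
  fixes f h :: "'a \<Rightarrow> real" and a b :: real
  assumes ab: "a > 1" "b > 1" "1 / a + 1 / b = 1"
    and [measurable]: "f \<in> borel_measurable M" "h \<in> borel_measurable M"
    and f: "integrable M (\<lambda>u. \<bar>f u\<bar> powr a)" and h: "integrable M (\<lambda>u. \<bar>h u\<bar> powr b)"
  shows "integrable M (\<lambda>u. f u * h u)"
    and "\<bar>LINT u|M. f u * h u\<bar> \<le> (LINT u|M. \<bar>f u\<bar> powr a) powr (1 / a) * (LINT u|M. \<bar>h u\<bar> powr b) powr (1 / b)"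
proof -
  have Young: "\<bar>f u * h u\<bar> \<le> \<bar>f u\<bar> powr a / a + \<bar>h u\<bar> powr b / b" for u
    using Youngs_inequality[OF ab, of "\<bar>f u\<bar>" "\<bar>h u\<bar>"] by (simp add: abs_mult)
  have i: "integrable M (\<lambda>u. \<bar>f u\<bar> powr a / a + \<bar>h u\<bar> powr b / b)" using f h by simp
  show fh: "integrable M (\<lambda>u. f u * h u)"
    by (rule Bochner_Integration.integrable_bound[OF i]) (use Young in \<open>auto intro!: AE_I2 order_trans[OF _ abs_ge_self]\<close>)
  define F where "F = (LINT u|M. \<bar>f u\<bar> powr a)"
  define G where "G = (LINT u|M. \<bar>h u\<bar> powr b)"
  have pos: "F \<ge> 0" "G \<ge> 0" by (simp_all add: F_def G_def)
  have zero: "(LINT u|M. f u * h u) = 0" if "F = 0 \<or> G = 0"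
  proof -
    have "AE u in M. \<bar>f u\<bar> powr a = 0 \<or> \<bar>h u\<bar> powr b = 0"
      using that unfolding F_def G_def
    proof
      assume "(LINT u|M. \<bar>f u\<bar> powr a) = 0"
      then show ?thesis using integral_nonneg_eq_0_iff_AE[OF f] by auto
    next
      assume "(LINT u|M. \<bar>h u\<bar> powr b) = 0"
      then show ?thesis using integral_nonneg_eq_0_iff_AE[OF h] by auto
    qed
    then have "AE u in M. f u * h u = 0" by eventually_elim auto
    then show ?thesis by (rule integral_eq_zero_AE)
  qed
  show "\<bar>LINT u|M. f u * h u\<bar> \<le> F powr (1 / a) * G powr (1 / b)"
  proof (cases "F = 0 \<or> G = 0")
    case True
    then show ?thesis using zero by auto
  next
    case False
    then have FG: "F > 0" "G > 0" using pos by auto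
    define A where "A = F powr (1 / a)"
    define B where "B = G powr (1 / b)"
    have AB: "A > 0" "B > 0" using FG by (simp_all add: A_def B_def)
    have pw: "A powr a = F" "B powr b = G" using FG ab by (simp_all add: A_def B_def powr_powr)
    \<comment> \<open>Young's inequality is applied after both functions have been scaled to norm \<open>1\<close>.\<close>
    have "\<bar>f u * h u\<bar> / (A * B) \<le> (\<bar>f u\<bar> powr a / F) / a + (\<bar>h u\<bar> powr b / G) / b" for u
      using Youngs_inequality[OF ab, of "\<bar>f u\<bar> / A" "\<bar>h u\<bar> / B"] AB
      by (simp add: abs_mult powr_divide pw)
    then have "(LINT u|M. \<bar>f u * h u\<bar> / (A * B)) \<le> (LINT u|M. (\<bar>f u\<bar> powr a / F) / a + (\<bar>h u\<bar> powr b / G) / b)"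
      using fh f h by (intro integral_mono) auto
    also have "\<dots> = (F / F) / a + (G / G) / b"
      unfolding F_def G_def using f h by simp
    also have "\<dots> = 1" using FG ab by simp
    finally have "(LINT u|M. \<bar>f u * h u\<bar>) \<le> A * B" using AB by simp
    then show ?thesis
      unfolding A_def B_def using integral_abs_bound[of M "\<lambda>u. f u * h u"] by linarith
  qed
qed

text \<open>In the first two cases boundedness almost everywhere of one of the factors takes the place of Hoelder's
  inequality for real exponents.\<close>

lemma conjugate_exponent_cases:
  fixes p q :: ennreal
  assumes "1 \<le> p" "1 / p + 1 / q = 1"
  obtains "p = 1" "q = \<infinity>" | "p = \<infinity>" "q = 1"
    | a b where "p = ennreal a" "q = ennreal b" "a > 1" "b > 1" "1 / a + 1 / b = 1"
proof -
  have reciprocal: "1 / ennreal c = ennreal (1 / c)" if "c > 0" for c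
    using divide_ennreal[of 1 c] that by simp
  show thesis
  proof (cases p)
    case top
    then have "1 / q = 1" using assms by simp
    have "q = 1"
    proof (cases q)
      case (real b)
      then have "b > 0" using \<open>1 / q = 1\<close> by (cases "b = 0") auto
      then have "ennreal (1 / b) = 1" using \<open>1 / q = 1\<close> real reciprocal by simp
      then show ?thesis using real \<open>b > 0\<close> by (simp add: ennreal_eq_1)
    qed (use \<open>1 / q = 1\<close> in simp)
    then show ?thesis using top that by auto
  next
    case (real a)
    then have "a \<ge> 1" using assms by simp
    then have ip: "1 / p = ennreal (1 / a)"
      using real reciprocal[of a] by simp
    show ?thesis
    proof (cases q)
      case top
      then have "ennreal (1 / a) = 1" using ip assms by simp
      then have "a = 1" by (simp add: ennreal_eq_1)
      then show ?thesis using real top that by auto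
    next
      case (real b)
      show ?thesis
      proof (cases "b = 0")
        case True
        then have "1 / q = \<infinity>" using real by simp
        then show ?thesis using assms by simp
      next
        case False
        then have b: "b > 0" using real by simp
        then have iq: "1 / q = ennreal (1 / b)" using real reciprocal by simp
        then have "ennreal (1 / a + 1 / b) = 1"
          using assms(2) \<open>a \<ge> 1\<close> b unfolding ip iq by simp
        then have *: "1 / a + 1 / b = 1" by (simp add: ennreal_eq_1)
        have "a \<noteq> 1" using * b by auto
        then have "a > 1" using \<open>a \<ge> 1\<close> by simp
        then have "1 / b < 1" using * by (smt (verit) zero_less_divide_1_iff)
        then have "b > 1" using b by simp
        show ?thesis using that(3)[of a b] \<open>p = ennreal a\<close> real \<open>a > 1\<close> \<open>b > 1\<close> * by simp
      qed
    qed
  qed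
qed

lemma conjugate_exponent_ge_1:
  fixes p q :: ennreal
  assumes "1 \<le> p" "1 / p + 1 / q = 1"
  shows "1 \<le> q"
  using conjugate_exponent_cases[OF assms] by cases auto

lemma Lp_mult_integrable:
  assumes pq: "1 \<le> p" "1 / p + 1 / q = 1" and f: "f \<in> Lp p" and h: "h \<in> Lp q"
  shows "integrable lebesgue (\<lambda>u. f u * h u)"
  using pq
proof (cases rule: conjugate_exponent_cases)
  case 1
  then obtain C where "AE u in lebesgue. \<bar>h u\<bar> \<le> C" "h \<in> borel_measurable lebesgue"
    using h Lp_top by auto
  then show ?thesis using f 1 by (auto simp: Lp_1 intro: integrable_mult_AE_bounded)
next
  case 2
  then obtain C where "AE u in lebesgue. \<bar>f u\<bar> \<le> C" "f \<in> borel_measurable lebesgue"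
    using f Lp_top by auto
  then have "integrable lebesgue (\<lambda>u. h u * f u)"
    using h 2 by (auto simp: Lp_1 intro: integrable_mult_AE_bounded)
  then show ?thesis by (simp add: mult.commute)
next
  case (3 a b)
  then show ?thesis using f h by (intro Hoelder_inequality(1)[of a b]) (auto simp: Lp_def)
qed

text \<open>The easy half of the duality of \<open>L\<^sup>p\<close> and \<open>L\<^sup>q\<close>: testing against \<open>L\<^sup>q\<close> is weakly continuous on \<open>L\<^sup>p\<close>.
  The boundedness is Hoelder's inequality if \<open>p < \<infinity>\<close>; if \<open>p = \<infinity>\<close>, these are the functionals that define
  the weak* topology.\<close>

lemma integral_against_conjugate_is_weak_functional:
  assumes pq: "1 \<le> p" "1 / p + 1 / q = 1" and h: "h \<in> Lp q"
  shows "(\<lambda>f. LINT u|lebesgue. f u * h u) \<in> Lp_weak_functionals p"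
proof -
  let ?\<Phi> = "\<lambda>f. LINT u|lebesgue. f u * h u"
  have int: "integrable lebesgue (\<lambda>u. f u * h u)" if "f \<in> Lp p" for f
    using Lp_mult_integrable[OF pq that h] .
  have dual: "?\<Phi> \<in> Lp_dual p" if "\<And>f. f \<in> Lp p \<Longrightarrow> \<bar>?\<Phi> f\<bar> \<le> C * Lp_norm p f" for C
    unfolding Lp_dual_def using that
    by (auto simp: distrib_right int mult.assoc intro!: exI[of _ C])
  from pq show ?thesis
  proof (cases rule: conjugate_exponent_cases)
    case 1
    then obtain C where "AE u in lebesgue. \<bar>h u\<bar> \<le> C" "h \<in> borel_measurable lebesgue"
      using h Lp_top by auto
    then have "\<bar>?\<Phi> f\<bar> \<le> \<bar>C\<bar> * Lp_norm p f" if "f \<in> Lp p" for f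
      using integrable_mult_AE_bounded(2)[of f h C] that 1 by (simp add: Lp_norm_def Lp_1)
    from dual[OF this] show ?thesis using 1 by (simp add: Lp_weak_functionals_def)
  next
    case 2
    then show ?thesis using h by (auto simp: Lp_weak_functionals_def)
  next
    case (3 a b)
    have "\<bar>?\<Phi> f\<bar> \<le> (LINT u|lebesgue. \<bar>h u\<bar> powr b) powr (1 / b) * Lp_norm p f" if "f \<in> Lp p" for f
      using Hoelder_inequality(2)[of a b f lebesgue h] that h 3 by (simp add: Lp_norm_def Lp_def mult.commute)
    from dual[OF this] show ?thesis using 3 by (simp add: Lp_weak_functionals_def)
  qed
qed

lemma Lp_weak_functionals_nonempty: "\<exists>\<Phi>. \<Phi> \<in> Lp_weak_functionals p"
proof (cases "p = \<infinity>")
  case True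
  have "(\<lambda>u. 0) \<in> Lp 1" by (simp add: Lp_1)
  then show ?thesis using True by (auto simp: Lp_weak_functionals_def)
next
  case False
  have "(\<lambda>f. 0) \<in> Lp_dual p" by (auto simp: Lp_dual_def intro: exI[of _ 0])
  then show ?thesis using False by (auto simp: Lp_weak_functionals_def)
qed

lemma topspace_Lp_weak: "topspace (Lp_weak p) = Lp p"
proof -
  obtain \<Phi> where "\<Phi> \<in> Lp_weak_functionals p" using Lp_weak_functionals_nonempty by blast
  then show ?thesis
    by (auto simp: Lp_weak_def topology_generated_by_topspace intro!: exI[of _ \<Phi>] exI[of _ UNIV])
qed

lemma continuous_map_Lp_weak_functional:
  assumes "\<Phi> \<in> Lp_weak_functionals p"
  shows "continuous_map (Lp_weak p) euclidean \<Phi>"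
  unfolding continuous_map_def topspace_Lp_weak
proof safe
  fix U :: "real set" assume "openin euclidean U"
  then have "{f \<in> Lp p. \<Phi> f \<in> U} \<in> {{f \<in> Lp p. \<Phi> f \<in> U} | \<Phi> U. \<Phi> \<in> Lp_weak_functionals p \<and> open U}"
    using assms by auto
  then show "openin (Lp_weak p) {f \<in> Lp p. \<Phi> f \<in> U}"
    unfolding Lp_weak_def by (rule topology_generated_by_Basis)
qed simp

lemma Lp_weak_limit_integral:
  assumes "1 \<le> p" "1 / p + 1 / q = 1" "h \<in> Lp q" and "limitin (Lp_weak p) F f sequentially"
  shows "(\<lambda>n. LINT u|lebesgue. F n u * h u) \<longlonglongrightarrow> (LINT u|lebesgue. f u * h u)"
proof -
  have "limitin euclidean ((\<lambda>f. LINT u|lebesgue. f u * h u) \<circ> F) (LINT u|lebesgue. f u * h u) sequentially"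
    using integral_against_conjugate_is_weak_functional[OF assms(1-3)]
    by (intro continuous_map_limit[OF continuous_map_Lp_weak_functional assms(4)])
  then show ?thesis by (simp add: o_def)
qed

lemma Lp_weak_continuous_integral:
  assumes "1 \<le> p" "1 / p + 1 / q = 1" "h \<in> Lp q" and "continuous_map (top_of_set S) (Lp_weak p) L"
  shows "continuous_on S (\<lambda>t. LINT u|lebesgue. L t u * h u)"
proof -
  have "continuous_map (top_of_set S) euclidean ((\<lambda>f. LINT u|lebesgue. f u * h u) \<circ> L)"
    using integral_against_conjugate_is_weak_functional[OF assms(1-3)]
    by (intro continuous_map_compose[OF assms(4)] continuous_map_Lp_weak_functional)
  then show ?thesis by (simp add: o_def)
qed

section \<open>The Taylor remainder kernel\<close>

text \<open>For fixed \<open>u\<close>, the kernel is the first order Taylor remainder at \<open>a\<close> of the convex function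
  \<open>v \<mapsto> max 0 (v - u)\<close>: it equals \<open>max 0 (b - u) - max 0 (a - u) - 1\<^bsub>u < a\<^esub> (b - a)\<close>.\<close>

definition local_time_kernel :: "real \<Rightarrow> real \<Rightarrow> real \<Rightarrow> real" where
  "local_time_kernel a b u = indicator (oriented_Ico a b) u * \<bar>b - u\<bar>"

text \<open>The function \<open>1\<^bsub>u < b\<^esub> - 1\<^bsub>u < a\<^esub>\<close>, whose integral against a function is its integral from \<open>a\<close> to \<open>b\<close>.\<close>

definition signed_Ico :: "real \<Rightarrow> real \<Rightarrow> real \<Rightarrow> real" where
  "signed_Ico a b u = indicator {a..<b} u - indicator {b..<a} u"

text \<open>The right-hand side is \<open>max 0 (b - u) - max 0 (a - u) - 1\<^bsub>u < c\<^esub> (b - a)\<close>, and replacing the slope \<open>1\<^bsub>u < c\<^esub>\<close>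
  of the linear part by \<open>1\<^bsub>u < a\<^esub>\<close> turns it into \<open>local_time_kernel a b u\<close>; the first summand on the left accounts
  for the change of slope. This pointwise identity replaces the integration by parts in the proof of the
  Taylor formula.\<close>

lemma local_time_kernel_cocycle:
  "signed_Ico c a u * (b - a) + local_time_kernel a b u = local_time_kernel c b u - local_time_kernel c a u"
  by (auto simp: signed_Ico_def local_time_kernel_def oriented_Ico_def split: split_indicator)

lemma local_time_kernel_self [simp]: "local_time_kernel a a u = 0"
  by (simp add: local_time_kernel_def oriented_Ico_def)

lemma local_time_kernel_nonneg: "0 \<le> local_time_kernel a b u"
  by (simp add: local_time_kernel_def)

lemma local_time_kernel_le:
  assumes "a \<in> {-M..M}" "b \<in> {-M..M}"
  shows "local_time_kernel a b u \<le> \<bar>b - a\<bar> * indicator {-M..M} u"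
  using assms by (auto simp: local_time_kernel_def oriented_Ico_def split: split_indicator)

lemma local_time_kernel_Lipschitz:
  assumes "c \<in> {-M..M}" "y \<in> {-M..M}" "z \<in> {-M..M}"
  shows "\<bar>local_time_kernel c y u - local_time_kernel c z u\<bar> \<le> \<bar>y - z\<bar> * indicator {-M..M} u"
  using assms by (auto simp: local_time_kernel_def oriented_Ico_def split: split_indicator)

lemma local_time_kernel_measurable [measurable]: "local_time_kernel a b \<in> borel_measurable lebesgue"
proof -
  have [measurable]: "oriented_Ico a b \<in> sets borel" by (simp add: oriented_Ico_def)
  have "local_time_kernel a b \<in> borel_measurable lborel"
    unfolding local_time_kernel_def[abs_def] by measurable
  then show ?thesis by (rule measurable_completion)
qed

lemma local_time_kernel_Lp: "local_time_kernel a b \<in> Lp p"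
proof -
  define M where "M = max \<bar>a\<bar> \<bar>b\<bar>"
  have "a \<in> {-M..M}" "b \<in> {-M..M}" by (auto simp: M_def)
  then have "0 \<le> local_time_kernel a b u \<and> local_time_kernel a b u \<le> \<bar>b - a\<bar> * indicator {-M..M} u" for u
    by (simp add: local_time_kernel_le local_time_kernel_nonneg del: atLeastAtMost_iff)
  note bd = this
  show ?thesis
  proof (rule bounded_support_Lp[of _ "\<bar>b - a\<bar>" M])
    fix u
    have "\<bar>b - a\<bar> * indicator {-M..M} u \<le> \<bar>b - a\<bar>" by (simp split: split_indicator)
    then show "\<bar>local_time_kernel a b u\<bar> \<le> \<bar>b - a\<bar>" using bd[of u] by linarith
    show "local_time_kernel a b u = 0" if "u \<notin> {-M..M}" using bd[of u] that by simp
  qed measurable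
qed

lemma indicator_Lp:
  assumes "A \<in> sets borel" "A \<subseteq> {-M..M}"
  shows "indicator A \<in> Lp p"
proof (rule bounded_support_Lp[of _ 1 M])
  have "(indicator A :: real \<Rightarrow> real) \<in> borel_measurable lborel" using assms(1) by simp
  then show "(indicator A :: real \<Rightarrow> real) \<in> borel_measurable lebesgue" by (rule measurable_completion)
qed (use assms(2) in \<open>auto split: split_indicator\<close>)

lemma indicator_interval_Lp: "indicator {a..b} \<in> Lp p" "indicator {a..<b} \<in> Lp p"
  by (rule indicator_Lp[of _ "max \<bar>a\<bar> \<bar>b\<bar>"]; force)+

lemma signed_Ico_Lp: "signed_Ico a b \<in> Lp p"
proof (rule bounded_support_Lp[of _ 1 "max \<bar>a\<bar> \<bar>b\<bar>"])
  show "signed_Ico a b \<in> borel_measurable lebesgue"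
    unfolding signed_Ico_def[abs_def]
    by (intro borel_measurable_diff Lp_measurable[OF indicator_interval_Lp(2)])
qed (auto simp: signed_Ico_def split: split_indicator)

lemma W1_FTC:
  assumes pq: "1 \<le> p" "1 / p + 1 / q = 1" and g: "g \<in> W1 q"
  shows "g a - g c = (LINT u|lebesgue. signed_Ico c a u * deriv g u)"
proof -
  have main: "g b - g a = (LINT u|lebesgue. indicator {a..<b} u * deriv g u)" if "a \<le> b" for a b
  proof -
    obtain N where N: "N \<in> null_sets lebesgue" "{u. \<not> g differentiable (at u)} \<subseteq> N"
      using g unfolding W1_def by (auto elim!: AE_E2 simp: eventually_ae_filter)
    have "(deriv g has_integral (g b - g a)) {a..b}"
    proof (rule fundamental_theorem_of_calculus_absolutely_continuous[OF that])
      show "absolutely_continuous_on_set {a..b} g" using g by (simp add: W1_def)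
      show "negligible N" using N by (simp add: negligible_iff_null_sets)
      fix u assume "u \<in> {a..b} - N"
      then have "g differentiable (at u)" using N by auto
      then show "(g has_real_derivative deriv g u) (at u)"
        by (simp add: DERIV_deriv_iff_real_differentiable)
    qed
    moreover have "set_integrable lebesgue {a..b} (deriv g)"
      using Lp_mult_integrable[OF pq indicator_interval_Lp(1)[of a b], of "deriv g"] g
      by (simp add: set_integrable_def W1_def)
    from has_integral_set_lebesgue[OF this]
    have "(deriv g has_integral (LINT u|lebesgue. indicator {a..b} u * deriv g u)) {a..b}"
      by (simp add: set_lebesgue_integral_def)
    ultimately have "g b - g a = (LINT u|lebesgue. indicator {a..b} u * deriv g u)"
      by (rule has_integral_unique)
    also have "\<dots> = (LINT u|lebesgue. indicator {a..<b} u * deriv g u)"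
    proof (rule integral_cong_AE)
      have "{b} \<in> null_sets lebesgue" by simp
      then have "AE u in lebesgue. u \<noteq> b" by (rule AE_I') auto
      then show "AE u in lebesgue. indicator {a..b} u * deriv g u = indicator {a..<b} u * deriv g u"
        by eventually_elim (auto split: split_indicator)
    qed (use g in \<open>auto simp: W1_def intro!: borel_measurable_times Lp_measurable[OF indicator_interval_Lp(1)] Lp_measurable[OF indicator_interval_Lp(2)] Lp_measurable[of "deriv g" q]\<close>)
    finally show ?thesis .
  qed
  show ?thesis
  proof (cases "c \<le> a")
    case True
    then show ?thesis using main[OF True] by (simp add: signed_Ico_def)
  next
    case False
    then show ?thesis using main[of a c] by (simp add: signed_Ico_def)
  qed
qed

lemma local_time_kernel_mult_integrable:
  assumes "1 \<le> p" "1 / p + 1 / q = 1" "h \<in> Lp q"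
  shows "integrable lebesgue (\<lambda>u. local_time_kernel a b u * h u)"
  using Lp_mult_integrable[OF assms(1,2) local_time_kernel_Lp assms(3)] .

text \<open>The cocycle identity integrated against \<open>g'\<close>. It writes one summand of the Riemann sum together with one
  summand of the local time as an increment of a single function of the position, which makes the sum over
  a partition telescope.\<close>

lemma W1_increment:
  assumes pq: "1 \<le> p" "1 / p + 1 / q = 1" and g: "g \<in> W1 q"
  shows "g a * (b - a) + (LINT u|lebesgue. local_time_kernel a b u * deriv g u)
    = (g c * b + (LINT u|lebesgue. local_time_kernel c b u * deriv g u))
      - (g c * a + (LINT u|lebesgue. local_time_kernel c a u * deriv g u))"
proof -
  have h: "deriv g \<in> Lp q" using g by (simp add: W1_def)
  note int = local_time_kernel_mult_integrable[OF pq h]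
  have "integrable lebesgue (\<lambda>u. signed_Ico c a u * deriv g u)"
    using Lp_mult_integrable[OF pq signed_Ico_Lp h] .
  then have "(g a - g c) * (b - a) + (LINT u|lebesgue. local_time_kernel a b u * deriv g u)
      = (LINT u|lebesgue. (signed_Ico c a u * deriv g u) * (b - a) + local_time_kernel a b u * deriv g u)"
    using int by (simp add: W1_FTC[OF pq g])
  also have "\<dots> = (LINT u|lebesgue. local_time_kernel c b u * deriv g u - local_time_kernel c a u * deriv g u)"
    by (rule Bochner_Integration.integral_cong[OF refl], subst left_diff_distrib[symmetric],
        subst local_time_kernel_cocycle[symmetric]) (simp add: algebra_simps)
  also have "\<dots> = (LINT u|lebesgue. local_time_kernel c b u * deriv g u) - (LINT u|lebesgue. local_time_kernel c a u * deriv g u)"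
    using int by simp
  finally show ?thesis by (simp add: algebra_simps)
qed

section \<open>Discrete Tanaka formula\<close>

text \<open>The minimum is finite, so that the conversion to a real number loses nothing; the value of the path at
  infinite times never occurs.\<close>

definition stopped_time :: "(nat \<Rightarrow> ennreal) \<Rightarrow> real \<Rightarrow> nat \<Rightarrow> real" where
  "stopped_time \<pi> t j = enn2real (min (\<pi> j) (ennreal t))"

lemma path_at_stopped: "path_at x (min (\<pi> j) (ennreal t)) = x (stopped_time \<pi> t j)"
proof -
  have "min (\<pi> j) (ennreal t) \<noteq> \<infinity>" by (metis ennreal_less_top infinity_ennreal_def min.strict_coboundedI2 neq_iff)
  then show ?thesis by (simp add: path_at_def stopped_time_def)
qed

lemma time_partition_mono:
  assumes "time_partition \<pi>" shows "mono \<pi>"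
  unfolding mono_iff_le_Suc
proof
  fix n
  show "\<pi> n \<le> \<pi> (Suc n)"
  proof (cases "\<pi> (Suc n) = \<infinity>")
    case False
    then have "\<pi> (Suc n) < \<infinity>" by (simp add: less_top)
    then show ?thesis using assms by (simp add: time_partition_def less_imp_le)
  qed simp
qed

lemma time_partition_exceeds:
  assumes "time_partition \<pi>"
  obtains N where "\<And>j. N \<le> j \<Longrightarrow> ennreal t < \<pi> j"
proof -
  have "\<pi> \<longlonglongrightarrow> \<infinity>" using assms by (simp add: time_partition_def)
  then have "\<forall>\<^sub>F j in sequentially. ennreal t < \<pi> j" by (rule order_tendstoD) simp
  then show ?thesis using that by (auto simp: eventually_sequentially)
qed

lemma stopped_time_after: "0 \<le> t \<Longrightarrow> ennreal t \<le> \<pi> j \<Longrightarrow> stopped_time \<pi> t j = t"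
  by (simp add: stopped_time_def min_absorb2)

lemma stopped_time_before: "\<pi> j \<le> ennreal t \<Longrightarrow> stopped_time \<pi> t j = enn2real (\<pi> j)"
  by (simp add: stopped_time_def min_absorb1)

lemma stopped_time_0: "time_partition \<pi> \<Longrightarrow> stopped_time \<pi> t 0 = 0"
  by (simp add: stopped_time_def time_partition_def)

lemma stopped_time_range:
  assumes "0 \<le> t" shows "stopped_time \<pi> t j \<in> {0..t}"
  using assms enn2real_mono[of "min (\<pi> j) (ennreal t)" "ennreal t"] by (simp add: stopped_time_def)

lemma disc_local_time_sum:
  assumes t: "0 \<le> t" and N: "\<And>j. N \<le> j \<Longrightarrow> ennreal t < \<pi> j"
  shows "disc_local_time x \<pi> t u
    = 2 * (\<Sum>j<N. local_time_kernel (x (stopped_time \<pi> t j)) (x (stopped_time \<pi> t (Suc j))) u)"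
proof -
  have "disc_local_time x \<pi> t u
      = 2 * (\<Sum>j. local_time_kernel (x (stopped_time \<pi> t j)) (x (stopped_time \<pi> t (Suc j))) u)"
    by (simp add: disc_local_time_def local_time_kernel_def path_at_stopped)
  also have "(\<Sum>j. local_time_kernel (x (stopped_time \<pi> t j)) (x (stopped_time \<pi> t (Suc j))) u)
      = (\<Sum>j<N. local_time_kernel (x (stopped_time \<pi> t j)) (x (stopped_time \<pi> t (Suc j))) u)"
    by (rule suminf_finite) (use N t in \<open>auto simp: stopped_time_after less_imp_le not_less\<close>)
  finally show ?thesis .
qed

lemma riemann_sum_sum:
  assumes \<pi>: "time_partition \<pi>" and t: "0 \<le> t" and N: "\<And>j. N \<le> j \<Longrightarrow> ennreal t < \<pi> j"
  shows "riemann_sum g x \<pi> t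
    = (\<Sum>j<N. g (x (stopped_time \<pi> t j)) * (x (stopped_time \<pi> t (Suc j)) - x (stopped_time \<pi> t j)))"
proof -
  have "riemann_sum g x \<pi> t
      = (\<Sum>j. g (path_at x (\<pi> j)) * (x (stopped_time \<pi> t (Suc j)) - x (stopped_time \<pi> t j)))"
    by (simp add: riemann_sum_def path_at_stopped)
  also have "\<dots> = (\<Sum>j<N. g (path_at x (\<pi> j)) * (x (stopped_time \<pi> t (Suc j)) - x (stopped_time \<pi> t j)))"
    by (rule suminf_finite) (use N t in \<open>auto simp: stopped_time_after less_imp_le not_less\<close>)
  also have "\<dots> = (\<Sum>j<N. g (x (stopped_time \<pi> t j)) * (x (stopped_time \<pi> t (Suc j)) - x (stopped_time \<pi> t j)))"
  proof (rule sum.cong[OF refl])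
    fix j
    show "g (path_at x (\<pi> j)) * (x (stopped_time \<pi> t (Suc j)) - x (stopped_time \<pi> t j))
      = g (x (stopped_time \<pi> t j)) * (x (stopped_time \<pi> t (Suc j)) - x (stopped_time \<pi> t j))"
    proof (cases "\<pi> j \<le> ennreal t")
      case True
      then show ?thesis using path_at_stopped[of x \<pi> j t] by (simp add: min_absorb1)
    next
      case False
      then have "ennreal t \<le> \<pi> j" "ennreal t \<le> \<pi> (Suc j)"
        using monoD[OF time_partition_mono[OF \<pi>], of j "Suc j"] by auto
      then show ?thesis using t by (simp add: stopped_time_after)
    qed
  qed
  finally show ?thesis .
qed

lemma disc_local_time_mult_integrable:
  assumes pq: "1 \<le> p" "1 / p + 1 / q = 1" "h \<in> Lp q" and \<pi>: "time_partition \<pi>" and t: "0 \<le> t"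
  shows "integrable lebesgue (\<lambda>u. disc_local_time x \<pi> t u * h u)"
proof -
  obtain N where "\<And>j. N \<le> j \<Longrightarrow> ennreal t < \<pi> j" using time_partition_exceeds[OF \<pi>] by blast
  from disc_local_time_sum[OF t this] show ?thesis
    using local_time_kernel_mult_integrable[OF pq] by (simp add: sum_distrib_right mult.assoc)
qed

lemma discrete_Tanaka_formula:
  assumes pq: "1 \<le> p" "1 / p + 1 / q = 1" and g: "g \<in> W1 q" and \<pi>: "time_partition \<pi>" and t: "0 \<le> t"
  shows "riemann_sum g x \<pi> t = g (x 0) * (x t - x 0)
    + (LINT u|lebesgue. local_time_kernel (x 0) (x t) u * deriv g u)
    - (LINT u|lebesgue. disc_local_time x \<pi> t u * deriv g u) / 2"
proof -
  have h: "deriv g \<in> Lp q" using g by (simp add: W1_def)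
  obtain N where N: "\<And>j. N \<le> j \<Longrightarrow> ennreal t < \<pi> j" using time_partition_exceeds[OF \<pi>] by blast
  define y where "y j = x (stopped_time \<pi> t j)" for j
  define \<psi> where "\<psi> b = g (x 0) * b + (LINT u|lebesgue. local_time_kernel (x 0) b u * deriv g u)" for b
  have yN: "y 0 = x 0" "y N = x t"
    using stopped_time_after[OF t, of \<pi> N] N[of N] stopped_time_0[OF \<pi>, of t] by (simp_all add: y_def)
  have "(LINT u|lebesgue. disc_local_time x \<pi> t u * deriv g u)
      = (LINT u|lebesgue. 2 * (\<Sum>j<N. local_time_kernel (y j) (y (Suc j)) u * deriv g u))"
    using disc_local_time_sum[OF t N] by (simp add: y_def sum_distrib_right mult.assoc)
  also have "\<dots> = 2 * (\<Sum>j<N. LINT u|lebesgue. local_time_kernel (y j) (y (Suc j)) u * deriv g u)"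
    using local_time_kernel_mult_integrable[OF pq h] by simp
  finally have "riemann_sum g x \<pi> t + (LINT u|lebesgue. disc_local_time x \<pi> t u * deriv g u) / 2
      = (\<Sum>j<N. g (y j) * (y (Suc j) - y j) + (LINT u|lebesgue. local_time_kernel (y j) (y (Suc j)) u * deriv g u))"
    using riemann_sum_sum[OF \<pi> t N, where g = g and x = x] by (simp add: y_def sum.distrib)
  also have "\<dots> = (\<Sum>j<N. \<psi> (y (Suc j)) - \<psi> (y j))"
    unfolding \<psi>_def by (intro sum.cong refl W1_increment[OF pq g])
  also have "\<dots> = \<psi> (x t) - \<psi> (x 0)"
    using sum_lessThan_telescope[of "\<lambda>j. \<psi> (y j)" N] by (simp add: yN)
  finally show ?thesis by (simp add: \<psi>_def algebra_simps)
qed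

lemma pathwise_integral_eq:
  assumes pq: "1 \<le> p" "1 / p + 1 / q = 1" and g: "g \<in> W1 q"
    and \<pi>s: "\<And>n. time_partition (\<pi>s n)" and t: "0 \<le> t"
    and l: "limitin (Lp_weak p) (\<lambda>n. disc_local_time x (\<pi>s n) t) l sequentially"
  shows "pathwise_integral g x \<pi>s t = g (x 0) * (x t - x 0)
    + (LINT u|lebesgue. local_time_kernel (x 0) (x t) u * deriv g u)
    - (LINT u|lebesgue. l u * deriv g u) / 2"
proof -
  have "deriv g \<in> Lp q" using g by (simp add: W1_def)
  from Lp_weak_limit_integral[OF pq this l]
  have "(\<lambda>n. riemann_sum g x (\<pi>s n) t) \<longlonglongrightarrow> g (x 0) * (x t - x 0)
    + (LINT u|lebesgue. local_time_kernel (x 0) (x t) u * deriv g u)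
    - (LINT u|lebesgue. l u * deriv g u) / 2"
    unfolding discrete_Tanaka_formula[OF pq g \<pi>s t] by (intro tendsto_intros) simp_all
  then show ?thesis unfolding pathwise_integral_def by (rule limI)
qed

section \<open>Near monotonicity of discrete local times\<close>

lemma abs_increment_le_osc:
  assumes bd: "\<And>r. r \<in> {0..s} \<Longrightarrow> \<bar>x r\<bar> \<le> M"
    and ab: "a \<in> {0..s}" "b \<in> {0..s}" "ennreal a \<in> {\<pi> k..<\<pi> (Suc k)}" "ennreal b \<in> {\<pi> k..<\<pi> (Suc k)}"
  shows "\<bar>x b - x a\<bar> \<le> osc x \<pi> s"
  unfolding osc_def
proof (rule cSup_upper)
  show "bdd_above {\<bar>x b - x a\<bar> | a b k. a \<in> {0..s} \<and> b \<in> {0..s} \<and>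
     ennreal a \<in> {\<pi> k..<\<pi> (Suc k)} \<and> ennreal b \<in> {\<pi> k..<\<pi> (Suc k)}}"
  proof (rule bdd_aboveI[of _ "2 * M"], safe)
    fix a b assume "a \<in> {0..s}" "b \<in> {0..s}"
    then show "\<bar>x b - x a\<bar> \<le> 2 * M" using bd[of a] bd[of b] by linarith
  qed
qed (use ab in blast)

text \<open>Compare the summands \<open>j\<close> at the times \<open>s \<le> t\<close>. Up to the last partition point before \<open>s\<close> they agree; those
  beyond \<open>s\<close> vanish at time \<open>s\<close> and are nonnegative at time \<open>t\<close>. The only summand that may decrease is the
  one whose interval contains \<open>s\<close>, and at time \<open>s\<close> it is at most the oscillation of the path there.\<close>

lemma disc_local_time_almost_mono:
  assumes \<pi>: "time_partition \<pi>" and st: "0 \<le> s" "s \<le> t"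
    and bd: "\<And>r. r \<in> {0..t} \<Longrightarrow> \<bar>x r\<bar> \<le> M"
  shows "disc_local_time x \<pi> s u \<le> disc_local_time x \<pi> t u + 2 * osc x \<pi> s * indicator {-M..M} u"
proof -
  have "0 \<le> t" using st by simp
  obtain N where N: "\<And>j. N \<le> j \<Longrightarrow> ennreal t < \<pi> j" using time_partition_exceeds[OF \<pi>] by blast
  have Ns: "ennreal s < \<pi> j" if "N \<le> j" for j
    using N[OF that] st by (meson ennreal_leI le_less_trans)
  note mono = monoD[OF time_partition_mono[OF \<pi>]]
  have "\<pi> 0 \<le> ennreal s" using \<pi> by (simp add: time_partition_def)
  have "finite {j. \<pi> j \<le> ennreal s}"
    by (rule finite_subset[of _ "{..<N}"]) (use Ns in \<open>force simp: not_less[symmetric]\<close>)+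
  define k where "k = Max {j. \<pi> j \<le> ennreal s}"
  have k: "\<pi> k \<le> ennreal s" "\<And>j. \<pi> j \<le> ennreal s \<Longrightarrow> j \<le> k"
    using Max_in[OF \<open>finite {j. \<pi> j \<le> ennreal s}\<close>] Max_ge[OF \<open>finite {j. \<pi> j \<le> ennreal s}\<close>] \<open>\<pi> 0 \<le> ennreal s\<close>
    unfolding k_def by auto
  have "k < N" using k(1) Ns[of k] by (meson leD not_le)
  have k': "ennreal s < \<pi> (Suc k)" using k(2)[of "Suc k"] by (meson Suc_n_not_le_n not_le)
  let ?K = "\<lambda>t j. local_time_kernel (x (stopped_time \<pi> t j)) (x (stopped_time \<pi> t (Suc j))) u"
  have "?K s j \<le> ?K t j + (if j = k then osc x \<pi> s * indicator {-M..M} u else 0)" for j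
  proof (cases j k rule: linorder_cases)
    case less
    then have "\<pi> j \<le> ennreal s" "\<pi> (Suc j) \<le> ennreal s"
      using mono[of j k] mono[of "Suc j" k] k(1) by auto
    moreover from this have "\<pi> j \<le> ennreal t" "\<pi> (Suc j) \<le> ennreal t"
      using st by (meson ennreal_leI order_trans)+
    ultimately show ?thesis using less by (simp add: stopped_time_before)
  next
    case equal
    have sk: "stopped_time \<pi> s k = enn2real (\<pi> k)" "stopped_time \<pi> s (Suc k) = s"
      using k k' st by (simp_all add: stopped_time_before stopped_time_after less_imp_le)
    have rng: "enn2real (\<pi> k) \<in> {0..s}" using stopped_time_range[OF st(1), of \<pi> k] sk by simp
    have fin: "ennreal (enn2real (\<pi> k)) = \<pi> k"
      using k(1) by (metis ennreal_enn2real_if ennreal_less_top leD top_greatest less_top order_le_less_trans)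
    have "?K s k \<le> \<bar>x s - x (enn2real (\<pi> k))\<bar> * indicator {-M..M} u"
      unfolding sk using bd[of s] bd[of "enn2real (\<pi> k)"] st rng
      by (intro local_time_kernel_le) (auto simp: abs_le_iff)
    also have "\<dots> \<le> osc x \<pi> s * indicator {-M..M} u"
    proof (rule mult_right_mono)
      show "\<bar>x s - x (enn2real (\<pi> k))\<bar> \<le> osc x \<pi> s"
        by (rule abs_increment_le_osc[of s x M _ _ \<pi> k])
           (use bd st rng k k' fin mono[of k "Suc k"] in auto)
    qed simp
    finally show ?thesis using equal by (simp add: local_time_kernel_nonneg add_increasing)
  next
    case greater
    then have "ennreal s \<le> \<pi> j" "ennreal s \<le> \<pi> (Suc j)"
      using mono[of "Suc k" j] mono[of "Suc k" "Suc j"] k' by auto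
    then show ?thesis using greater st by (simp add: stopped_time_after local_time_kernel_nonneg)
  qed
  then have "(\<Sum>j<N. ?K s j) \<le> (\<Sum>j<N. ?K t j + (if j = k then osc x \<pi> s * indicator {-M..M} u else 0))"
    by (rule sum_mono)
  also have "\<dots> = (\<Sum>j<N. ?K t j) + osc x \<pi> s * indicator {-M..M} u"
    using \<open>k < N\<close> by (simp add: sum.distrib)
  finally show ?thesis
    using disc_local_time_sum[OF st(1) Ns] disc_local_time_sum[OF \<open>0 \<le> t\<close> N] by simp
qed

text \<open>If the increment of the discrete local time were nonnegative, this would be the triangle inequality without the last term. A function
  \<open>d \<ge> - r\<close> with \<open>r \<ge> 0\<close> still satisfies \<open>\<bar>d\<bar> \<le> d + 2 r\<close>.\<close>

lemma disc_local_time_integral_increment: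
  assumes pq: "1 \<le> p" "1 / p + 1 / q = 1" and h: "h \<in> Lp q"
    and \<pi>: "time_partition \<pi>" and st: "0 \<le> s" "s \<le> t"
    and bd: "\<And>r. r \<in> {0..t} \<Longrightarrow> \<bar>x r\<bar> \<le> M"
  shows "\<bar>(LINT u|lebesgue. disc_local_time x \<pi> t u * h u) - (LINT u|lebesgue. disc_local_time x \<pi> s u * h u)\<bar>
    \<le> (LINT u|lebesgue. disc_local_time x \<pi> t u * \<bar>h u\<bar>) - (LINT u|lebesgue. disc_local_time x \<pi> s u * \<bar>h u\<bar>)
      + 4 * osc x \<pi> s * (LINT u|lebesgue. indicator {-M..M} u * \<bar>h u\<bar>)"
proof -
  let ?A = "disc_local_time x \<pi> t" and ?B = "disc_local_time x \<pi> s" and ?o = "osc x \<pi> s"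
  have t: "0 \<le> t" using st by simp
  note int = disc_local_time_mult_integrable[OF pq h \<pi>] disc_local_time_mult_integrable[OF pq Lp_abs[OF h] \<pi>]
  have inti: "integrable lebesgue (\<lambda>u. indicator {-M..M} u * \<bar>h u\<bar>)"
    using Lp_mult_integrable[OF pq indicator_interval_Lp(1) Lp_abs[OF h]] .
  have le: "\<bar>?A u * h u - ?B u * h u\<bar> \<le> ?A u * \<bar>h u\<bar> - ?B u * \<bar>h u\<bar> + 4 * ?o * (indicator {-M..M} u * \<bar>h u\<bar>)" for u
  proof -
    \<comment> \<open>The second inequality, the case \<open>s = t\<close>, says that the error term is nonnegative.\<close>
    have "?B u \<le> ?A u + 2 * ?o * indicator {-M..M} u" "?B u \<le> ?B u + 2 * ?o * indicator {-M..M} u"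
      by (rule disc_local_time_almost_mono[OF \<pi>]; use st bd in simp)+
    then have "\<bar>?A u - ?B u\<bar> \<le> ?A u - ?B u + 4 * ?o * indicator {-M..M} u"
      unfolding mult.assoc by linarith
    from mult_right_mono[OF this abs_ge_zero[of "h u"]] show ?thesis
      by (simp add: abs_mult[symmetric] algebra_simps)
  qed
  have "\<bar>(LINT u|lebesgue. ?A u * h u) - (LINT u|lebesgue. ?B u * h u)\<bar>
      = \<bar>LINT u|lebesgue. ?A u * h u - ?B u * h u\<bar>"
    using int st t by simp
  also have "\<dots> \<le> (LINT u|lebesgue. \<bar>?A u * h u - ?B u * h u\<bar>)"
    by (rule integral_abs_bound)
  also have "\<dots> \<le> (LINT u|lebesgue. ?A u * \<bar>h u\<bar> - ?B u * \<bar>h u\<bar> + 4 * ?o * (indicator {-M..M} u * \<bar>h u\<bar>))"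
    by (rule integral_mono) (use int st t inti le in auto)
  also have "\<dots> = (LINT u|lebesgue. ?A u * \<bar>h u\<bar>) - (LINT u|lebesgue. ?B u * \<bar>h u\<bar>)
      + 4 * ?o * (LINT u|lebesgue. indicator {-M..M} u * \<bar>h u\<bar>)"
    using int st t inti by simp
  finally show ?thesis .
qed

text \<open>An integrated form of the monotonicity of the local time in \<open>t\<close>. It is the limit of the inequality for the
  discrete local times, in which the error term disappears with the oscillation.\<close>

lemma local_time_integral_increment:
  assumes pq: "1 \<le> p" "1 / p + 1 / q = 1" and h: "h \<in> Lp q"
    and x: "continuous_on {0..} x" and \<pi>s: "\<And>n. time_partition (\<pi>s n)"
    and osc: "(\<lambda>n. osc x (\<pi>s n) s) \<longlonglongrightarrow> 0" and st: "0 \<le> s" "s \<le> t"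
    and ls: "limitin (Lp_weak p) (\<lambda>n. disc_local_time x (\<pi>s n) s) ls sequentially"
    and lt: "limitin (Lp_weak p) (\<lambda>n. disc_local_time x (\<pi>s n) t) lt sequentially"
  shows "\<bar>(LINT u|lebesgue. lt u * h u) - (LINT u|lebesgue. ls u * h u)\<bar>
    \<le> (LINT u|lebesgue. lt u * \<bar>h u\<bar>) - (LINT u|lebesgue. ls u * \<bar>h u\<bar>)"
proof -
  have "compact (x ` {0..t})"
    by (intro compact_continuous_image continuous_on_subset[OF x]) auto
  then obtain M where M: "\<And>r. r \<in> {0..t} \<Longrightarrow> \<bar>x r\<bar> \<le> M"
    using compact_imp_bounded[THEN bounded_iff[THEN iffD1]] by fastforce
  let ?C = "LINT u|lebesgue. indicator {-M..M} u * \<bar>h u\<bar>"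
  note lim = Lp_weak_limit_integral[OF pq h] Lp_weak_limit_integral[OF pq Lp_abs[OF h]]
  have "(\<lambda>n. (LINT u|lebesgue. disc_local_time x (\<pi>s n) t u * \<bar>h u\<bar>)
        - (LINT u|lebesgue. disc_local_time x (\<pi>s n) s u * \<bar>h u\<bar>) + 4 * osc x (\<pi>s n) s * ?C)
      \<longlonglongrightarrow> (LINT u|lebesgue. lt u * \<bar>h u\<bar>) - (LINT u|lebesgue. ls u * \<bar>h u\<bar>) + 4 * 0 * ?C"
    by (intro tendsto_intros lim ls lt osc)
  moreover have "(\<lambda>n. \<bar>(LINT u|lebesgue. disc_local_time x (\<pi>s n) t u * h u)
        - (LINT u|lebesgue. disc_local_time x (\<pi>s n) s u * h u)\<bar>)
      \<longlonglongrightarrow> \<bar>(LINT u|lebesgue. lt u * h u) - (LINT u|lebesgue. ls u * h u)\<bar>"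
    by (intro tendsto_intros lim ls lt)
  ultimately have "\<bar>(LINT u|lebesgue. lt u * h u) - (LINT u|lebesgue. ls u * h u)\<bar>
      \<le> (LINT u|lebesgue. lt u * \<bar>h u\<bar>) - (LINT u|lebesgue. ls u * \<bar>h u\<bar>) + 4 * 0 * ?C"
    using disc_local_time_integral_increment[OF pq h \<pi>s st M]
    by (intro LIMSEQ_le) auto
  then show ?thesis by simp
qed

section \<open>Uniform convergence from dominated increments\<close>

text \<open>A version of the theorem of Polya and Dini: between two neighbouring points of a fine grid, \<open>\<phi> n\<close> moves by at
  most the increment of \<open>m n\<close> over the cell, which is close to the increment of the uniformly continuous
  function \<open>m0\<close>. Convergence at the finitely many grid points is therefore enough.\<close>

lemma uniform_limit_of_dominated_increments:
  fixes \<phi> m :: "nat \<Rightarrow> real \<Rightarrow> real"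
  assumes incr: "\<And>n s t. a \<le> s \<Longrightarrow> s \<le> t \<Longrightarrow> t \<le> b \<Longrightarrow> \<bar>\<phi> n t - \<phi> n s\<bar> \<le> m n t - m n s"
    and \<phi>: "\<And>s. s \<in> {a..b} \<Longrightarrow> (\<lambda>n. \<phi> n s) \<longlonglongrightarrow> \<phi>0 s"
    and m: "\<And>s. s \<in> {a..b} \<Longrightarrow> (\<lambda>n. m n s) \<longlonglongrightarrow> m0 s"
    and cont: "continuous_on {a..b} m0"
  shows "uniform_limit {a..b} \<phi> \<phi>0 sequentially"
proof (cases "a \<le> b")
  case True
  have incr0: "\<bar>\<phi>0 t - \<phi>0 s\<bar> \<le> m0 t - m0 s" if "a \<le> s" "s \<le> t" "t \<le> b" for s t
    by (rule LIMSEQ_le[of "\<lambda>n. \<bar>\<phi> n t - \<phi> n s\<bar>" _ "\<lambda>n. m n t - m n s"])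
       (use that incr in \<open>auto intro!: tendsto_intros \<phi> m\<close>)
  show ?thesis
  proof (rule uniform_limitI)
    fix \<epsilon> :: real assume "\<epsilon> > 0"
    have "uniformly_continuous_on {a..b} m0"
      using cont by (intro compact_uniformly_continuous) auto
    then obtain \<delta> where "\<delta> > 0"
      and \<delta>: "\<And>s t. s \<in> {a..b} \<Longrightarrow> t \<in> {a..b} \<Longrightarrow> \<bar>t - s\<bar> < \<delta> \<Longrightarrow> \<bar>m0 t - m0 s\<bar> < \<epsilon> / 5"
      unfolding uniformly_continuous_on_def dist_real_def using \<open>\<epsilon> > 0\<close> by (metis zero_less_divide_iff zero_less_numeral)
    define d where "d = \<delta> / 2"
    have d: "d > 0" "d < \<delta>" using \<open>\<delta> > 0\<close> by (auto simp: d_def)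
    \<comment> \<open>The minimum keeps the last grid point inside the interval.\<close>
    define T where "T i = min b (a + real i * d)" for i
    have T: "T i \<in> {a..b}" for i using True d by (auto simp: T_def)
    define N where "N = nat \<lceil>(b - a) / d\<rceil> + 1"
    have "\<forall>\<^sub>F n in sequentially. \<forall>i\<in>{..N}. \<bar>\<phi> n (T i) - \<phi>0 (T i)\<bar> < \<epsilon> / 5 \<and> \<bar>m n (T i) - m0 (T i)\<bar> < \<epsilon> / 5"
    proof (intro eventually_ball_finite ballI eventually_conj)
      fix i
      have "\<epsilon> / 5 > 0" using \<open>\<epsilon> > 0\<close> by simp
      then show "\<forall>\<^sub>F n in sequentially. \<bar>\<phi> n (T i) - \<phi>0 (T i)\<bar> < \<epsilon> / 5"
        "\<forall>\<^sub>F n in sequentially. \<bar>m n (T i) - m0 (T i)\<bar> < \<epsilon> / 5"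
        using tendstoD[OF \<phi>[OF T[of i]]] tendstoD[OF m[OF T[of i]]]
        unfolding dist_real_def by blast+
    qed simp
    then show "\<forall>\<^sub>F n in sequentially. \<forall>s\<in>{a..b}. dist (\<phi> n s) (\<phi>0 s) < \<epsilon>"
    proof (rule eventually_mono, intro ballI)
      fix n s
      assume *: "\<forall>i\<in>{..N}. \<bar>\<phi> n (T i) - \<phi>0 (T i)\<bar> < \<epsilon> / 5 \<and> \<bar>m n (T i) - m0 (T i)\<bar> < \<epsilon> / 5"
        and s: "s \<in> {a..b}"
      define i where "i = nat \<lfloor>(s - a) / d\<rfloor>"
      have i: "real i \<le> (s - a) / d" "(s - a) / d < real (Suc i)"
      proof -
        have "(s - a) / d \<ge> 0" using s d by simp
        then show "real i \<le> (s - a) / d" "(s - a) / d < real (Suc i)"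
          unfolding i_def by linarith+
      qed
      have "real i \<le> (b - a) / d" using i(1) s d by (meson atLeastAtMost_iff diff_right_mono divide_right_mono less_imp_le order_trans)
      then have "Suc i \<le> N" unfolding N_def by linarith
      have bounds: "real i * d \<le> s - a" "s - a \<le> real (Suc i) * d"
        using i d by (simp_all add: field_simps)
      have Ti: "T i = a + real i * d" "T i \<le> s" "s \<le> T (Suc i)"
        using bounds s by (auto simp: T_def)
      have "T (Suc i) \<le> T i + d" unfolding Ti(1) by (auto simp: T_def field_simps)
      then have "\<bar>T (Suc i) - T i\<bar> < \<delta>" "\<bar>s - T i\<bar> < \<delta>" using Ti d by auto
      then have cont': "\<bar>m0 (T (Suc i)) - m0 (T i)\<bar> < \<epsilon> / 5" "\<bar>m0 s - m0 (T i)\<bar> < \<epsilon> / 5"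
        using \<delta> T s by blast+
      have close: "\<bar>\<phi> n (T i) - \<phi>0 (T i)\<bar> < \<epsilon> / 5" "\<bar>m n (T i) - m0 (T i)\<bar> < \<epsilon> / 5"
        "\<bar>m n (T (Suc i)) - m0 (T (Suc i))\<bar> < \<epsilon> / 5"
        using * \<open>Suc i \<le> N\<close> by auto
      have "\<bar>\<phi> n s - \<phi> n (T i)\<bar> \<le> m n s - m n (T i)" "\<bar>\<phi> n (T (Suc i)) - \<phi> n s\<bar> \<le> m n (T (Suc i)) - m n s"
        "\<bar>\<phi>0 s - \<phi>0 (T i)\<bar> \<le> m0 s - m0 (T i)"
        using incr[of "T i" s n] incr[of s "T (Suc i)" n] incr0[of "T i" s] Ti T[of i] T[of "Suc i"] s by auto
      with cont' close show "dist (\<phi> n s) (\<phi>0 s) < \<epsilon>"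
        unfolding dist_real_def by linarith
    qed
  qed
qed simp

section \<open>Continuity of the pathwise integral in the integrand\<close>

text \<open>A Lipschitz estimate, stated with a monotone function \<open>z \<mapsto> C z\<close> that dominates the increments, as
  \<open>uniform_limit_of_dominated_increments\<close> needs it.\<close>

lemma Tanaka_term_increment:
  assumes pq: "1 \<le> p" "1 / p + 1 / q = 1" and h: "h \<in> Lp q"
    and c: "c \<in> {-M..M}" and yz: "-M \<le> y" "y \<le> z" "z \<le> M"
  shows "\<bar>(a * (z - c) + (LINT u|lebesgue. local_time_kernel c z u * h u))
      - (a * (y - c) + (LINT u|lebesgue. local_time_kernel c y u * h u))\<bar>
    \<le> (\<bar>a\<bar> + (LINT u|lebesgue. indicator {-M..M} u * \<bar>h u\<bar>)) * z
      - (\<bar>a\<bar> + (LINT u|lebesgue. indicator {-M..M} u * \<bar>h u\<bar>)) * y"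
proof -
  let ?C = "LINT u|lebesgue. indicator {-M..M} u * \<bar>h u\<bar>"
  note int = local_time_kernel_mult_integrable[OF pq h]
  have "integrable lebesgue (\<lambda>u. indicator {-M..M} u * \<bar>h u\<bar>)"
    using Lp_mult_integrable[OF pq indicator_interval_Lp(1) Lp_abs[OF h]] .
  then have inti: "integrable lebesgue (\<lambda>u. (z - y) * (indicator {-M..M} u * \<bar>h u\<bar>))" by simp
  have le: "\<bar>local_time_kernel c z u * h u - local_time_kernel c y u * h u\<bar>
      \<le> (z - y) * (indicator {-M..M} u * \<bar>h u\<bar>)" for u
    using mult_right_mono[OF local_time_kernel_Lipschitz[OF c, of z y u] abs_ge_zero[of "h u"]] yz
    by (simp add: abs_mult[symmetric] left_diff_distrib mult.assoc)
  have "\<bar>(LINT u|lebesgue. local_time_kernel c z u * h u) - (LINT u|lebesgue. local_time_kernel c y u * h u)\<bar>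
      = \<bar>LINT u|lebesgue. local_time_kernel c z u * h u - local_time_kernel c y u * h u\<bar>"
    using int by simp
  also have "\<dots> \<le> (LINT u|lebesgue. \<bar>local_time_kernel c z u * h u - local_time_kernel c y u * h u\<bar>)"
    by (rule integral_abs_bound)
  also have "\<dots> \<le> (LINT u|lebesgue. (z - y) * (indicator {-M..M} u * \<bar>h u\<bar>))"
    by (rule integral_mono) (use int inti le in auto)
  also have "\<dots> = (z - y) * ?C" by simp
  finally have "\<bar>(LINT u|lebesgue. local_time_kernel c z u * h u) - (LINT u|lebesgue. local_time_kernel c y u * h u)\<bar>
      \<le> (z - y) * ?C" .
  moreover have "\<bar>a * (z - c) - a * (y - c)\<bar> = (z - y) * \<bar>a\<bar>"
    using yz by (simp add: right_diff_distrib[symmetric] abs_mult)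
  ultimately have "\<bar>(a * (z - c) + (LINT u|lebesgue. local_time_kernel c z u * h u))
      - (a * (y - c) + (LINT u|lebesgue. local_time_kernel c y u * h u))\<bar> \<le> (z - y) * \<bar>a\<bar> + (z - y) * ?C"
    by linarith
  also have "\<dots> = (\<bar>a\<bar> + ?C) * z - (\<bar>a\<bar> + ?C) * y" by (simp add: algebra_simps)
  finally show ?thesis .
qed

theorem proposition3p2:
  fixes p q :: ennreal
    and x :: "real \<Rightarrow> real"
    and \<pi>s :: "nat \<Rightarrow> nat \<Rightarrow> ennreal"
    and g :: "real \<Rightarrow> real"
    and gs :: "nat \<Rightarrow> real \<Rightarrow> real"
  assumes "1 \<le> p" and "1 / p + 1 / q = 1"
    and "continuous_on {0..} x"
    and "\<And>n. time_partition (\<pi>s n)"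
    and "\<And>t. 0 \<le> t \<Longrightarrow> (\<lambda>n. osc x (\<pi>s n) t) \<longlonglongrightarrow> 0"
    and "x \<in> local_time_paths p \<pi>s"
    and "\<And>n. gs n \<in> W1 q" and "g \<in> W1 q"
    and "(\<lambda>n. gs n (x 0)) \<longlonglongrightarrow> g (x 0)"
    and "limitin (Lp_weak q) (\<lambda>n. deriv (gs n)) (deriv g) sequentially"
  shows "(\<forall>t\<ge>0. (\<lambda>n. pathwise_integral (gs n) x \<pi>s t) \<longlonglongrightarrow> pathwise_integral g x \<pi>s t) \<and>
    (limitin (Lp_weak q) (\<lambda>n u. \<bar>deriv (gs n) u\<bar>) (\<lambda>u. \<bar>deriv g u\<bar>) sequentially \<longrightarrow>
      (\<forall>K. compact K \<and> K \<subseteq> {0..} \<longrightarrow>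
        uniform_limit K (\<lambda>n. pathwise_integral (gs n) x \<pi>s) (pathwise_integral g x \<pi>s) sequentially))"
proof -
  note pq = assms(1,2) and x = assms(3) and \<pi>s = assms(4) and osc = assms(5)
    and gs = assms(7) and g = assms(8) and g0 = assms(9) and weak = assms(10)
  have qp: "1 \<le> q" "1 / q + 1 / p = 1"
    using conjugate_exponent_ge_1[OF pq] pq by (simp_all add: add.commute)
  have h: "deriv (gs n) \<in> Lp q" "deriv g \<in> Lp q" for n
    using gs g by (simp_all add: W1_def)
  obtain L where L: "\<And>t. 0 \<le> t \<Longrightarrow> limitin (Lp_weak p) (\<lambda>n. disc_local_time x (\<pi>s n) t) (L t) sequentially"
    and Lcont: "continuous_map (top_of_set {0..}) (Lp_weak p) L"
    using assms(6) unfolding local_time_paths_def by blast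
  have LLp: "L t \<in> Lp p" if "0 \<le> t" for t
    using limitin_topspace[OF L[OF that]] by (simp add: topspace_Lp_weak)
  define A where "A f y = f (x 0) * (y - x 0) + (LINT u|lebesgue. local_time_kernel (x 0) y u * deriv f u)" for f y
  define B where "B h t = (LINT u|lebesgue. L t u * h u)" for h t
  have eq: "pathwise_integral f x \<pi>s t = A f (x t) - B (deriv f) t / 2" if "f \<in> W1 q" "0 \<le> t" for f t
    using pathwise_integral_eq[OF pq that(1) \<pi>s that(2) L[OF that(2)]] by (simp add: A_def B_def)
  have tested: "(\<lambda>n. LINT u|lebesgue. k u * hs n u) \<longlonglongrightarrow> (LINT u|lebesgue. k u * h u)"
    if "limitin (Lp_weak q) hs h sequentially" "k \<in> Lp p" for hs h k
    using Lp_weak_limit_integral[OF qp that(2,1)] by (simp add: mult.commute)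
  have A: "(\<lambda>n. A (gs n) y) \<longlonglongrightarrow> A g y" for y
    unfolding A_def by (intro tendsto_intros g0 tested[OF weak] local_time_kernel_Lp)
  have B: "(\<lambda>n. B (hs n) t) \<longlonglongrightarrow> B h t" if "limitin (Lp_weak q) hs h sequentially" "0 \<le> t" for hs h t
    unfolding B_def by (intro tested that LLp)
  show ?thesis
  proof (intro conjI allI impI)
    fix t :: real assume t: "0 \<le> t"
    show "(\<lambda>n. pathwise_integral (gs n) x \<pi>s t) \<longlonglongrightarrow> pathwise_integral g x \<pi>s t"
      unfolding eq[OF gs t] eq[OF g t] by (intro tendsto_intros A B weak t) simp
  next
    fix K :: "real set"
    assume abs_weak: "limitin (Lp_weak q) (\<lambda>n u. \<bar>deriv (gs n) u\<bar>) (\<lambda>u. \<bar>deriv g u\<bar>) sequentially"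
      and K: "compact K \<and> K \<subseteq> {0..}"
    obtain T where "\<And>t. t \<in> K \<Longrightarrow> \<bar>t\<bar> \<le> T"
      using K compact_imp_bounded[of K] by (auto simp: bounded_iff)
    then have KT: "K \<subseteq> {0..T}" using K by fastforce
    \<comment> \<open>The maximum puts the time \<open>0\<close> into the interval, so that \<open>x 0\<close>, too, lies in the range of the bound.\<close>
    have "compact (x ` {0..max T 0})"
      by (intro compact_continuous_image continuous_on_subset[OF x]) auto
    then obtain M where M: "\<And>t. t \<in> {0..max T 0} \<Longrightarrow> \<bar>x t\<bar> \<le> M"
      using compact_imp_bounded[THEN bounded_iff[THEN iffD1]] by fastforce
    then have xM: "x t \<in> {-M..M}" if "t \<in> {0..max T 0}" for t
      using M[OF that] by (auto simp: abs_le_iff)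
    have B_unif: "uniform_limit {0..T} (\<lambda>n. B (deriv (gs n))) (B (deriv g)) sequentially"
    proof (rule uniform_limit_of_dominated_increments)
      show "\<bar>B (deriv (gs n)) t - B (deriv (gs n)) s\<bar>
          \<le> B (\<lambda>u. \<bar>deriv (gs n) u\<bar>) t - B (\<lambda>u. \<bar>deriv (gs n) u\<bar>) s" if "0 \<le> s" "s \<le> t" for n s t
        unfolding B_def using that
        by (intro local_time_integral_increment[OF pq h(1) x \<pi>s osc that L L]) auto
      show "continuous_on {0..T} (B (\<lambda>u. \<bar>deriv g u\<bar>))"
        unfolding B_def
        by (rule continuous_on_subset[OF Lp_weak_continuous_integral[OF pq Lp_abs[OF h(2)] Lcont]]) auto
    qed (auto intro: B weak abs_weak)
    define C where "C f = \<bar>f (x 0)\<bar> + (LINT u|lebesgue. indicator {-M..M} u * \<bar>deriv f u\<bar>)" for f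
    have "uniform_limit {-M..M} (\<lambda>n. A (gs n)) (A g) sequentially"
    proof (rule uniform_limit_of_dominated_increments)
      show "\<bar>A (gs n) z - A (gs n) y\<bar> \<le> C (gs n) * z - C (gs n) * y" if "-M \<le> y" "y \<le> z" "z \<le> M" for n y z
        unfolding A_def C_def using that xM[of 0]
        by (intro Tanaka_term_increment[OF pq h(1)]) auto
      show "(\<lambda>n. C (gs n) * y) \<longlonglongrightarrow> C g * y" for y
        unfolding C_def by (intro tendsto_intros g0 tested[OF abs_weak] indicator_interval_Lp)
    qed (auto intro!: A continuous_intros)
    then have A_unif: "uniform_limit {0..T} (\<lambda>n t. A (gs n) (x t)) (\<lambda>t. A g (x t)) sequentially"
      by (rule uniform_limit_compose') (use xM in fastforce)
    have "uniform_limit {0..T} (\<lambda>n t. A (gs n) (x t) - B (deriv (gs n)) t / 2)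
        (\<lambda>t. A g (x t) - B (deriv g) t / 2) sequentially"
      by (intro uniform_limit_intros A_unif B_unif)
    then have "uniform_limit K (\<lambda>n t. A (gs n) (x t) - B (deriv (gs n)) t / 2)
        (\<lambda>t. A g (x t) - B (deriv g) t / 2) sequentially"
      using KT by (rule uniform_limit_on_subset)
    then show "uniform_limit K (\<lambda>n. pathwise_integral (gs n) x \<pi>s) (pathwise_integral g x \<pi>s) sequentially"
      by (rule uniform_limit_cong'[THEN iffD1, rotated 2]) (use KT gs g in \<open>auto simp: eq\<close>)
  qed
qed

end
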